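(* Let $k\ge 2$ be an integer. Then each of the four subgraphs $T_k^{(1)},T_k^{(2)},T_k^{(3)},T_k^{(4)}$ of the dense Gaussian network $G_k$ (defined in the context) is a spanning tree of $G_k$.
   Context: For an integer $k\ge 2$ let $\alpha_k=k+(k+1)i\in\mathbb{Z}[i]$. The dense Gaussian network $G_k=(V_k,E_k)$ is the undirected graph with node set $V_k=\{x+yi : x,y\in\mathbb{Z},\ |x|+|y|\le k\}$ (a complete system of representatives of $\mathbb{Z}[i]$ modulo $\alpha_k$), in which two nodes $A,B$ are adjacent if and only if $A-B$ is congruent modulo $\alpha_k$ to one of $1,-1,i,-i$. For $z\in\mathbb{Z}[i]$, $z \bmod \alpha_k$ denotes the unique element of $V_k$ congruent to $z$ modulo $\alpha_k$. All edges are regarded as undirected. Let $E_k^V=\{(v,(v+i)\bmod\alpha_k) : v\in V_k\}$ be the set of vertical edges. Define $$\begin{aligned}E_k^{(1)}=\Big(E_k^V&\setminus\big(\{(qi,(q+1)i): 0\le q\le k-1\}\cup\{(q-i,q): -k+1\le q\le 0\}\cup\{(-k,ki)\}\big)\Big)\\&\cup\{(q,q+1): 0\le q\le k-1\}\cup\{(-1+qi,qi): 1\le q\le k-1\}\cup\{(k,ki)\},\end{aligned}$$ where $q$ ranges over integers, and $T_k^{(1)}=(V_k,E_k^{(1)})$. Let $\rho:V_k\to V_k$, $\rho(x+yi)=-y+xi$ (counterclockwise rotation by $90^\circ$), extended to edges by $\rho(u,v)=(\rho(u),\rho(v))$ and to subgraphs by applying it to the node and edge sets. For $j=2,3,4$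 let $T_k^{(j)}=\rho^{\,j-1}(T_k^{(1)})$. *)

theory Defs
  imports Complex_Main
begin

text \<open>
  Finite simple undirected graphs, with edges as two-element sets of nodes. (The tree and forest
  predicates of the AFP entry on directed graphs are not suitable here: for them a closed walk
  $u, v, u$ in a symmetric digraph already is a cycle.)
\<close>

record 'a ugraph =
  nodes :: "'a set"
  edges :: "'a set set"

definition simple_ugraph :: "'a ugraph \<Rightarrow> bool" where
  "simple_ugraph G \<longleftrightarrow> finite (nodes G) \<and> (\<forall>e\<in>edges G. e \<subseteq> nodes G \<and> card e = 2)"

definition is_uwalk :: "'a ugraph \<Rightarrow> 'a list \<Rightarrow> bool" where
  "is_uwalk G p \<longleftrightarrow> p \<noteq> [] \<and> set p \<subseteq> nodes G \<and> successively (\<lambda>u v. {u, v} \<in> edges G) p"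

definition uconnected :: "'a ugraph \<Rightarrow> bool" where
  "uconnected G \<longleftrightarrow> nodes G \<noteq> {} \<and>
     (\<forall>u\<in>nodes G. \<forall>v\<in>nodes G. \<exists>p. is_uwalk G p \<and> hd p = u \<and> last p = v)"

text \<open>A cycle is listed without repeating its initial node at the end.\<close>

definition is_ucycle :: "'a ugraph \<Rightarrow> 'a list \<Rightarrow> bool" where
  "is_ucycle G p \<longleftrightarrow> length p \<ge> 3 \<and> distinct p \<and> is_uwalk G p \<and> {last p, hd p} \<in> edges G"

definition is_utree :: "'a ugraph \<Rightarrow> bool" where
  "is_utree G \<longleftrightarrow> simple_ugraph G \<and> uconnected G \<and> (\<nexists>p. is_ucycle G p)"

definition is_usubgraph :: "'a ugraph \<Rightarrow> 'a ugraph \<Rightarrow> bool" where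
  "is_usubgraph H G \<longleftrightarrow> simple_ugraph H \<and> simple_ugraph G \<and>
     nodes H \<subseteq> nodes G \<and> edges H \<subseteq> edges G"

definition is_spanning_utree :: "'a ugraph \<Rightarrow> 'a ugraph \<Rightarrow> bool" where
  "is_spanning_utree H G \<longleftrightarrow> is_usubgraph H G \<and> nodes H = nodes G \<and> is_utree H"

definition image_ugraph :: "('a \<Rightarrow> 'b) \<Rightarrow> 'a ugraph \<Rightarrow> 'b ugraph" where
  "image_ugraph f G = \<lparr>nodes = f ` nodes G, edges = (\<lambda>e. f ` e) ` edges G\<rparr>"


definition gauss_ints :: "complex set" where
  "gauss_ints = {of_int x + of_int y * \<i> | x y. True}"

definition gauss_alpha :: "int \<Rightarrow> complex" where
  "gauss_alpha k = of_int k + of_int (k + 1) * \<i>"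

definition gauss_cong :: "int \<Rightarrow> complex \<Rightarrow> complex \<Rightarrow> bool" where
  "gauss_cong k z w \<longleftrightarrow> (\<exists>c\<in>gauss_ints. z - w = gauss_alpha k * c)"

definition gauss_nodes :: "int \<Rightarrow> complex set" where
  "gauss_nodes k = {of_int x + of_int y * \<i> | x y. \<bar>x\<bar> + \<bar>y\<bar> \<le> k}"

text \<open>
  The node set is a complete system of representatives modulo \<open>gauss_alpha k\<close> (for \<open>k \<ge> 0\<close>), so
  the following description is uniquely satisfied for Gaussian integers \<open>z\<close>.
\<close>

definition gauss_mod :: "int \<Rightarrow> complex \<Rightarrow> complex" where
  "gauss_mod k z = (THE v. v \<in> gauss_nodes k \<and> gauss_cong k v z)"

definition gauss_network :: "int \<Rightarrow> complex ugraph" where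
  "gauss_network k = \<lparr>nodes = gauss_nodes k,
     edges = {{a, b} | a b. a \<in> gauss_nodes k \<and> b \<in> gauss_nodes k \<and>
                (\<exists>u\<in>{1, -1, \<i>, -\<i>}. gauss_cong k (a - b) u)}\<rparr>"

definition vertical_edges :: "int \<Rightarrow> complex set set" where
  "vertical_edges k = {{v, gauss_mod k (v + \<i>)} | v. v \<in> gauss_nodes k}"

definition tree1_edges :: "int \<Rightarrow> complex set set" where
  "tree1_edges k =
     (vertical_edges k -
       ({{of_int q * \<i>, of_int (q + 1) * \<i>} | q. 0 \<le> q \<and> q \<le> k - 1} \<union>
        {{of_int q - \<i>, of_int q} | q. - k + 1 \<le> q \<and> q \<le> 0} \<union>
        {{- of_int k, of_int k * \<i>}})) \<union>
     {{of_int q, of_int (q + 1)} | q. 0 \<le> q \<and> q \<le> k - 1} \<union>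
     {{-1 + of_int q * \<i>, of_int q * \<i>} | q. 1 \<le> q \<and> q \<le> k - 1} \<union>
     {{of_int k, of_int k * \<i>}}"

definition gauss_rot :: "complex \<Rightarrow> complex" where
  "gauss_rot z = Complex (- Im z) (Re z)"

definition gauss_tree :: "int \<Rightarrow> nat \<Rightarrow> complex ugraph" where
  "gauss_tree k j =
     (image_ugraph gauss_rot ^^ (j - 1)) \<lparr>nodes = gauss_nodes k, edges = tree1_edges k\<rparr>"

end

theory Submission
  imports Defs
begin

text \<open>
  The rotation is an automorphism of the network, so only the first subgraph matters. Its edges are
  exactly the pairs of a nonzero node and its parent, for a parent function along which an integer
  depth strictly decreases; such a graph is a tree rooted at \<open>0\<close>. All computations take place
  in integer coordinates.
\<close>

section \<open>Walks, cycles and trees given by a parent function\<close>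

lemma is_uwalk_join:
  assumes "is_uwalk G p" "is_uwalk G q" "last p = hd q"
  shows "\<exists>r. is_uwalk G r \<and> hd r = hd p \<and> last r = last q"
proof -
  obtain a q' where q: "q = a # q'"
    using assms(2) by (cases q) (auto simp: is_uwalk_def)
  have "is_uwalk G (p @ q')"
    using assms q by (auto simp: is_uwalk_def successively_append_iff successively_Cons)
  moreover have "hd (p @ q') = hd p" "last (p @ q') = last q"
    using assms q by (auto simp: is_uwalk_def)
  ultimately show ?thesis by blast
qed

lemma is_uwalk_edge:
  assumes "simple_ugraph G" "{u, v} \<in> edges G"
  shows "is_uwalk G [u, v]"
  using assms by (auto simp: is_uwalk_def simple_ugraph_def)

text \<open>Reading indices modulo the length puts the closing edge on the same footing as the
  others, so both neighbours of any node on a cycle are reached uniformly.\<close>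

lemma ucycle_edge_nth:
  assumes "is_ucycle G p" "i < length p"
  shows "{p ! i, p ! (Suc i mod length p)} \<in> edges G"
proof (cases "Suc i < length p")
  case True
  then show ?thesis
    using assms by (auto simp: is_ucycle_def is_uwalk_def successively_conv_nth)
next
  case False
  then have len: "length p = Suc i" using assms by simp
  then have "p \<noteq> []" by auto
  then have "last p = p ! i" "hd p = p ! (Suc i mod length p)"
    using len by (simp_all add: last_conv_nth hd_conv_nth)
  then show ?thesis using assms by (simp add: is_ucycle_def)
qed

lemma is_utree_parent:
  fixes rank :: "'a \<Rightarrow> nat"
  assumes "finite V" "r \<in> V"
    and par: "\<And>v. v \<in> V \<Longrightarrow> v \<noteq> r \<Longrightarrow> par v \<in> V \<and> rank (par v) < rank v"
  shows "is_utree \<lparr>nodes = V, edges = {{v, par v} | v. v \<in> V - {r}}\<rparr>" (is "is_utree ?G")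
  unfolding is_utree_def
proof (intro conjI)
  have "v \<noteq> par v" if "v \<in> V" "v \<noteq> r" for v
    using par[OF that] by auto
  then show simple: "simple_ugraph ?G"
    using assms by (auto simp: simple_ugraph_def)
  have edge: "is_uwalk ?G [v, par v]" "is_uwalk ?G [par v, v]" if "v \<in> V" "v \<noteq> r" for v
  proof -
    have "{v, par v} \<in> edges ?G" using that by auto
    then show "is_uwalk ?G [v, par v]" "is_uwalk ?G [par v, v]"
      using is_uwalk_edge[OF simple] by (simp_all add: insert_commute)
  qed
  \<comment> \<open>Walks to the root and walks from it are built side by side, so no walk ever has
    to be reversed.\<close>
  have root: "(\<exists>p. is_uwalk ?G p \<and> hd p = v \<and> last p = r) \<and>
              (\<exists>p. is_uwalk ?G p \<and> hd p = r \<and> last p = v)" if "v \<in> V" for v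
    using that
  proof (induction "rank v" arbitrary: v rule: less_induct)
    case less
    show ?case
    proof (cases "v = r")
      case True
      then have "is_uwalk ?G [v]" using less by (simp add: is_uwalk_def)
      then show ?thesis using True by (intro conjI exI[of _ "[v]"]) auto
    next
      case False
      obtain p q where p: "is_uwalk ?G p" "hd p = par v" "last p = r"
        and q: "is_uwalk ?G q" "hd q = r" "last q = par v"
        using less.hyps[of "par v"] par[OF less.prems False] by blast
      have "\<exists>s. is_uwalk ?G s \<and> hd s = v \<and> last s = r"
        using is_uwalk_join[OF edge(1)[OF less.prems False] p(1)] p(2,3) by simp
      moreover have "\<exists>s. is_uwalk ?G s \<and> hd s = r \<and> last s = v"
        using is_uwalk_join[OF q(1) edge(2)[OF less.prems False]] q(2,3) by simp
      ultimately show ?thesis by blast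
    qed
  qed
  show "uconnected ?G"
    unfolding uconnected_def
  proof (intro conjI ballI)
    show "nodes ?G \<noteq> {}" using assms by auto
  next
    fix u v assume "u \<in> nodes ?G" "v \<in> nodes ?G"
    then obtain p q where "is_uwalk ?G p" "hd p = u" "last p = r"
      and "is_uwalk ?G q" "hd q = r" "last q = v"
      using root[of u] root[of v] by auto
    then show "\<exists>p. is_uwalk ?G p \<and> hd p = u \<and> last p = v"
      using is_uwalk_join[of ?G p q] by auto
  qed
  \<comment> \<open>A node of maximal rank on a cycle would have its parent as both neighbours.\<close>
  show "\<nexists>p. is_ucycle ?G p"
  proof
    assume "\<exists>p. is_ucycle ?G p"
    then obtain p where p: "is_ucycle ?G p" by blast
    let ?n = "length p"
    have n: "?n \<ge> 3" "distinct p" using p by (auto simp: is_ucycle_def)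
    then have "finite (rank ` set p)" "rank ` set p \<noteq> {}" by auto
    then have "Max (rank ` set p) \<in> rank ` set p" by (rule Max_in)
    then obtain v where v: "v \<in> set p" "rank v = Max (rank ` set p)" by auto
    then have max: "rank w \<le> rank v" if "w \<in> set p" for w
      using that by simp
    \<comment> \<open>The other orientation of the edge, \<open>v = par w\<close>, would give
      \<open>rank v < rank w\<close>, against the maximality of \<open>v\<close>.\<close>
    have nbr: "w = par v" if "{v, w} \<in> edges ?G" "w \<in> set p" for w
      using that(1) max[OF that(2)] par by (auto simp: doubleton_eq_iff) (metis leD)+
    obtain i where i: "i < ?n" "p ! i = v" using v by (auto simp: in_set_conv_nth)
    \<comment> \<open>\<open>j\<close> is the cyclic predecessor of \<open>i\<close>. Both
      neighbours of position \<open>i\<close> carry \<open>par v\<close>, so distinctness makes the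
      two positions equal, while a length of at least 3 keeps them apart.\<close>
    define j where "j = (if i = 0 then ?n - 1 else i - 1)"
    have j: "j < ?n" "Suc j mod ?n = i" using i n by (auto simp: j_def)
    have "{v, p ! (Suc i mod ?n)} \<in> edges ?G" "{v, p ! j} \<in> edges ?G"
      using ucycle_edge_nth[OF p i(1)] ucycle_edge_nth[OF p j(1)] i(2) j(2)
      by (simp_all add: insert_commute)
    moreover have "p ! (Suc i mod ?n) \<in> set p" "p ! j \<in> set p"
      using n j by (auto intro!: nth_mem mod_less_divisor)
    ultimately have "p ! (Suc i mod ?n) = par v" "p ! j = par v"
      using nbr by blast+
    then have "Suc i mod ?n = j"
      using n j by (metis i(1) mod_less_divisor nth_eq_iff_index_eq less_zeroE neq0_conv)
    moreover have "Suc i mod ?n \<noteq> j"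
      using n i by (cases "Suc i = ?n") (auto simp: j_def)
    ultimately show False by simp
  qed
qed

section \<open>Transport of trees along injective maps\<close>

lemma is_uwalk_image:
  assumes "is_uwalk G p"
  shows "is_uwalk (image_ugraph f G) (map f p)"
proof -
  have "{f u, f v} \<in> edges (image_ugraph f G)" if "{u, v} \<in> edges G" for u v
    using that by (auto simp: image_ugraph_def intro: image_eqI[where x = "{u, v}"])
  then have "successively (\<lambda>u v. {f u, f v} \<in> edges (image_ugraph f G)) p"
    using assms unfolding is_uwalk_def by (blast intro: successively_mono)
  then show ?thesis
    using assms by (auto simp: is_uwalk_def successively_map image_ugraph_def)
qed

lemma simple_ugraph_image:
  assumes "simple_ugraph G" "inj_on f (nodes G)"
  shows "simple_ugraph (image_ugraph f G)"
  using assms by (auto simp: simple_ugraph_def image_ugraph_def card_image inj_on_subset)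

text \<open>Edges are sets of nodes, so injectivity on the nodes makes an edge recoverable from its
  image. This is what allows edges of the image graph to be pulled back.\<close>

lemma image_edge_iff:
  assumes "simple_ugraph G" "inj_on f (nodes G)" "u \<in> nodes G" "v \<in> nodes G"
  shows "{f u, f v} \<in> edges (image_ugraph f G) \<longleftrightarrow> {u, v} \<in> edges G"
proof -
  have "e = {u, v}" if "e \<in> edges G" "f ` e = f ` {u, v}" for e
    using inj_on_image_eq_iff[OF assms(2), of e "{u, v}"] that assms
    by (auto simp: simple_ugraph_def)
  then show ?thesis
    by (auto simp: image_ugraph_def intro: image_eqI[where x = "{u, v}"])
qed

lemma is_utree_image:
  assumes "is_utree G" "inj_on f (nodes G)"
  shows "is_utree (image_ugraph f G)" (is "is_utree ?H")
  unfolding is_utree_def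
proof (intro conjI)
  have simple: "simple_ugraph G" using assms by (simp add: is_utree_def)
  then show "simple_ugraph ?H" using simple_ugraph_image assms by blast
  show "uconnected ?H"
    unfolding uconnected_def
  proof (intro conjI ballI)
    show "nodes ?H \<noteq> {}"
      using assms by (auto simp: is_utree_def uconnected_def image_ugraph_def)
  next
    fix u v assume "u \<in> nodes ?H" "v \<in> nodes ?H"
    then obtain a b where ab: "a \<in> nodes G" "b \<in> nodes G" "u = f a" "v = f b"
      by (auto simp: image_ugraph_def)
    then obtain p where p: "is_uwalk G p" "hd p = a" "last p = b"
      using assms by (meson is_utree_def uconnected_def)
    moreover have "p \<noteq> []" using p by (simp add: is_uwalk_def)
    ultimately show "\<exists>p. is_uwalk ?H p \<and> hd p = u \<and> last p = v"
      using is_uwalk_image[of G p f] ab by (metis hd_map last_map)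
  qed
  show "\<nexists>p. is_ucycle ?H p"
  proof
    assume "\<exists>p. is_ucycle ?H p"
    then obtain p where p: "is_ucycle ?H p" by blast
    then have "set p \<subseteq> f ` nodes G"
      by (simp add: is_ucycle_def is_uwalk_def image_ugraph_def)
    \<comment> \<open>A cycle of the image graph is lifted to a node list \<open>q\<close> of
      \<open>G\<close>; the rest shows that \<open>q\<close> is a cycle of \<open>G\<close>.\<close>
    then have "p \<in> map f ` lists (nodes G)"
      by (auto simp: in_lists_conv_set simp flip: lists_image)
    then obtain q where q: "p = map f q" "set q \<subseteq> nodes G"
      by (auto simp: in_lists_conv_set)
    have "q \<noteq> []" using p q by (auto simp: is_ucycle_def)
    have walk: "successively (\<lambda>u v. {u, v} \<in> edges G) q"
    proof (rule successively_mono)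
      show "successively (\<lambda>u v. {f u, f v} \<in> edges ?H) q"
        using p q by (simp add: is_ucycle_def is_uwalk_def successively_map)
    qed (use q image_edge_iff[OF simple assms(2)] in auto)
    have "last q \<in> nodes G" "hd q \<in> nodes G"
      using q \<open>q \<noteq> []\<close> last_in_set hd_in_set by blast+
    moreover have "{f (last q), f (hd q)} \<in> edges ?H"
      using p \<open>q \<noteq> []\<close> unfolding q(1) by (simp add: is_ucycle_def last_map hd_map)
    ultimately have "{last q, hd q} \<in> edges G"
      using image_edge_iff[OF simple assms(2)] by blast
    moreover have "distinct q" "length q \<ge> 3"
      using p unfolding q(1) by (simp_all add: is_ucycle_def distinct_map)
    ultimately have "is_ucycle G q"
      using walk q(2) \<open>q \<noteq> []\<close> by (simp add: is_ucycle_def is_uwalk_def)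
    then show False using assms by (auto simp: is_utree_def)
  qed
qed

text \<open>Since \<open>f\<close> maps \<open>G\<close> onto itself, the ambient graph does not
  change, and the statement can be iterated over powers of the rotation.\<close>

lemma is_spanning_utree_image:
  assumes "is_spanning_utree T G" "inj_on f (nodes G)" "image_ugraph f G = G"
  shows "is_spanning_utree (image_ugraph f T) G"
proof -
  have T: "nodes T = nodes G" "is_utree T" "simple_ugraph G" "edges T \<subseteq> edges G"
    using assms by (auto simp: is_spanning_utree_def is_usubgraph_def)
  have utree: "is_utree (image_ugraph f T)"
    using is_utree_image T assms by metis
  moreover have "nodes (image_ugraph f T) = nodes (image_ugraph f G)"
    "edges (image_ugraph f T) \<subseteq> edges (image_ugraph f G)"
    using T by (auto simp: image_ugraph_def)
  ultimately show ?thesis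
    using T assms(3) by (auto simp: is_spanning_utree_def is_usubgraph_def is_utree_def)
qed

section \<open>Integer coordinates, residues modulo alpha and the vertical step\<close>

fun gauss :: "int \<times> int \<Rightarrow> complex" where
  "gauss (x, y) = of_int x + of_int y * \<i>"

lemma Re_gauss [simp]: "Re (gauss v) = of_int (fst v)"
  and Im_gauss [simp]: "Im (gauss v) = of_int (snd v)"
  by (cases v; simp)+

lemma gauss_eq_iff [simp]: "gauss u = gauss v \<longleftrightarrow> u = v"
  by (auto simp: complex_eq_iff prod_eq_iff)

lemma inj_gauss: "inj gauss"
  by (simp add: inj_def)

definition diamond :: "int \<Rightarrow> (int \<times> int) set" where
  "diamond k = {(x, y). \<bar>x\<bar> + \<bar>y\<bar> \<le> k}"

lemma gauss_nodes_eq: "gauss_nodes k = gauss ` diamond k"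
  by (force simp: gauss_nodes_def diamond_def image_iff)

lemma finite_diamond: "finite (diamond k)"
  by (rule finite_subset[of _ "{-k..k} \<times> {-k..k}"]) (auto simp: diamond_def)

lemma gauss_ints_eq: "gauss_ints = range gauss"
  by (force simp: gauss_ints_def image_iff)

lemma gauss_diff: "gauss (a, b) - gauss (c, d) = gauss (a - c, b - d)"
  by (simp add: complex_eq_iff)

lemma gauss_alpha_mult:
  "gauss_alpha k * gauss (m, n) = gauss (k * m - (k + 1) * n, (k + 1) * m + k * n)"
  by (simp add: gauss_alpha_def complex_eq_iff)

lemma gauss_cong_iff:
  "gauss_cong k (gauss (a, b)) (gauss (c, d)) \<longleftrightarrow>
    (\<exists>m n. a - c = k * m - (k + 1) * n \<and> b - d = (k + 1) * m + k * n)"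
  unfolding gauss_cong_def gauss_ints_eq gauss_diff
  by (simp add: gauss_alpha_mult del: gauss.simps)

text \<open>Two points of the diamond are at 1-norm distance at most 2k, whereas a nonzero multiple
  of alpha has 1-norm at least 2k + 1. This is the uniqueness half of the diamond being a system of
  representatives.\<close>

lemma gauss_cong_diamond_eq:
  assumes "u \<in> diamond k" "v \<in> diamond k" "gauss_cong k (gauss u) (gauss v)"
  shows "u = v"
proof -
  obtain a b c d where uv: "u = (a, b)" "v = (c, d)" by (metis surj_pair)
  then obtain m n where mn: "a - c = k * m - (k + 1) * n" "b - d = (k + 1) * m + k * n"
    using assms gauss_cong_iff by auto
  have k: "\<bar>a - c\<bar> + \<bar>b - d\<bar> \<le> 2 * k" "k \<ge> 0"
    using assms uv by (auto simp: diamond_def)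
  \<comment> \<open>One of the sum and the difference of the coordinates of \<open>u - v\<close> is too large:
    the second one if \<open>m\<close> and \<open>n\<close> have equal signs, the first one otherwise.\<close>
  let ?s = "(2 * k + 1) * m - n" and ?t = "m + (2 * k + 1) * n"
  have "?s = (a - c) + (b - d)" "?t = (b - d) - (a - c)"
    using mn by (simp_all add: algebra_simps)
  then have st: "\<bar>?s\<bar> \<le> 2 * k" "\<bar>?t\<bar> \<le> 2 * k"
    using k by linarith+
  have large: "(2 * k + 1) * x \<ge> 2 * k + 1" if "x \<ge> 1" for x
    using mult_left_mono[OF that, of "2 * k + 1"] k by simp
  have neg: "(2 * k + 1) * x = - ((2 * k + 1) * (- x))" for x
    by simp
  have "m = 0 \<and> n = 0"
  proof (rule ccontr)
    assume "\<not> (m = 0 \<and> n = 0)"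
    then consider "m \<ge> 1" "n \<le> 0" | "m \<le> -1" "n \<ge> 0" | "m \<ge> 0" "n \<ge> 1" | "m \<le> 0" "n \<le> -1"
      by linarith
    then show False
    proof cases
      case 1 then show ?thesis using st large[of m] by linarith
    next
      case 2 then show ?thesis using st large[of "-m"] neg[of m] by linarith
    next
      case 3 then show ?thesis using st large[of n] by linarith
    next
      case 4 then show ?thesis using st large[of "-n"] neg[of n] by linarith
    qed
  qed
  then show ?thesis using mn uv by simp
qed

text \<open>Evaluates the definite description from an explicit representative: two representatives
  of \<open>z\<close> are congruent to each other, so uniqueness in the diamond applies.\<close>

lemma gauss_mod_eq:
  assumes "v \<in> diamond k" "gauss_cong k (gauss v) z"
  shows "gauss_mod k z = gauss v"
  unfolding gauss_mod_def
proof (rule the_equality)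
  show "gauss v \<in> gauss_nodes k \<and> gauss_cong k (gauss v) z"
    using assms unfolding gauss_nodes_eq by blast
next
  fix w assume w: "w \<in> gauss_nodes k \<and> gauss_cong k w z"
  then obtain u where u: "w = gauss u" "u \<in> diamond k" unfolding gauss_nodes_eq by blast
  obtain c where c: "c \<in> gauss_ints" "gauss v - z = gauss_alpha k * c"
    using assms unfolding gauss_cong_def by blast
  obtain d where d: "d \<in> gauss_ints" "w - z = gauss_alpha k * d"
    using w unfolding gauss_cong_def by blast
  obtain a b a' b' where "c = gauss (a, b)" "d = gauss (a', b')"
    using c(1) d(1) unfolding gauss_ints_eq by fast
  then have "d - c \<in> gauss_ints" by (simp only: gauss_diff gauss_ints_eq rangeI)
  moreover have "w - gauss v = gauss_alpha k * (d - c)"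
    using c d by (simp add: algebra_simps)
  ultimately have "gauss_cong k (gauss u) (gauss v)"
    using u by (auto simp: gauss_cong_def)
  then show "w = gauss v" using gauss_cong_diamond_eq u assms by blast
qed

text \<open>The wrap-around cases are obtained by subtracting \<open>\<alpha>\<close> and \<open>\<alpha> \<i>\<close>, respectively.\<close>

fun up :: "int \<Rightarrow> int \<times> int \<Rightarrow> int \<times> int" where
  "up k (x, y) =
    (if \<bar>x\<bar> + \<bar>y + 1\<bar> \<le> k then (x, y + 1)
     else if x \<ge> 0 then (x - k, - x) else (x + k + 1, x + 1))"

lemma up_diamond: "v \<in> diamond k \<Longrightarrow> up k v \<in> diamond k"
  by (cases v) (auto simp: diamond_def)

lemma up_cong:
  assumes "v \<in> diamond k"
  shows "gauss_cong k (gauss (up k v)) (gauss v + \<i>)"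
proof -
  obtain x y where v: "v = (x, y)" by fastforce
  have i: "gauss v + \<i> = gauss (x, y + 1)" by (simp add: v algebra_simps)
  obtain a b where up: "up k v = (a, b)" by fastforce
  \<comment> \<open>A step up leaves the diamond only from y = k - |x|. Substituting this value
    turns the wrapped formulas of \<open>up\<close> into x + (y + 1)i minus alpha and minus alpha
    times i, which gives the witnesses -1, 0 and 0, -1 below.\<close>
  consider "a = x" "b = y + 1" | "a = x - k" "b = y - k"
    | "a = x + k + 1" "b = y + 1 - k"
    using assms up v by (auto simp: diamond_def split: if_splits)
  then show ?thesis
    unfolding i up gauss_cong_iff
  proof cases
    case 1 then show "\<exists>m n. a - x = k * m - (k + 1) * n \<and> b - (y + 1) = (k + 1) * m + k * n"
      by (intro exI[of _ 0]) auto
  next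
    case 2 then show "\<exists>m n. a - x = k * m - (k + 1) * n \<and> b - (y + 1) = (k + 1) * m + k * n"
      by (intro exI[of _ "-1"] exI[of _ 0]) auto
  next
    case 3 then show "\<exists>m n. a - x = k * m - (k + 1) * n \<and> b - (y + 1) = (k + 1) * m + k * n"
      by (intro exI[of _ 0] exI[of _ "-1"]) auto
  qed
qed

lemma gauss_mod_up: "v \<in> diamond k \<Longrightarrow> gauss_mod k (gauss v + \<i>) = gauss (up k v)"
  using gauss_mod_eq up_diamond up_cong by blast

section \<open>The parent function and its depth\<close>

text \<open>
  Rooting the tree at \<open>0\<close>, the nodes of a column to the right of the imaginary axis descend to the
  positive real axis, which leads to the root; the nodes to the left leave through the nearer end
  of their column. \<open>depth\<close> is the resulting distance from the root.
\<close>

fun parent :: "int \<Rightarrow> int \<times> int \<Rightarrow> int \<times> int" where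
  "parent k (x, y) =
    (if x > 0 then (if y = 0 then (x - 1, 0) else if y > 0 then (x, y - 1) else (x, y + 1))
     else if y < 0 then (if y - 1 < - (k + x) then (x + k, - x) else (x, y - 1))
     else if x = 0 then (if y = k then (k, 0) else (-1, y))
     else if y < k + x then (x, y + 1) else (x + k + 1, x + 1))"

fun depth :: "int \<Rightarrow> int \<times> int \<Rightarrow> int" where
  "depth k (x, y) =
    (if x > 0 \<or> x = 0 \<and> y = 0 then x + \<bar>y\<bar> else 2 * k + 1 + x - \<bar>y\<bar>)"

lemma depth_nonneg: "v \<in> diamond k \<Longrightarrow> depth k v \<ge> 0"
  by (cases v) (auto simp: diamond_def)

text \<open>Each move lowers the depth by exactly one. For x <= 0, away from the root, the depth
  falls to k + 1 on the boundary |x| + |y| = k; the edge taken there leads to a boundary node with x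
  > 0, whose depth is k.\<close>

lemma depth_parent:
  assumes "k \<ge> 1" "v \<in> diamond k" "v \<noteq> (0, 0)"
  shows "parent k v \<in> diamond k \<and> depth k (parent k v) < depth k v"
proof -
  obtain x y where v: "v = (x, y)" by fastforce
  then have xy: "\<bar>x\<bar> + \<bar>y\<bar> \<le> k" "x \<noteq> 0 \<or> y \<noteq> 0"
    using assms by (auto simp: diamond_def)
  consider "x > 0" "y = 0" | "x > 0" "y > 0" | "x > 0" "y < 0"
    | "x \<le> 0" "y < 0" "y - 1 < - (k + x)" | "x \<le> 0" "y < 0" "\<not> y - 1 < - (k + x)"
    | "x = 0" "y = k" | "x = 0" "0 < y" "y < k"
    | "x < 0" "0 \<le> y" "y < k + x" | "x < 0" "0 \<le> y" "\<not> y < k + x"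
    using xy by (smt (verit))
  then show ?thesis
    by cases (use assms in \<open>simp_all add: v diamond_def\<close>)
qed

section \<open>Parent edges agree with the edges of the first tree\<close>

definition parent_edges :: "int \<Rightarrow> (int \<times> int) set set" where
  "parent_edges k = {{v, parent k v} | v. v \<in> diamond k - {(0, 0)}}"

definition removed_edges :: "int \<Rightarrow> (int \<times> int) set set" where
  "removed_edges k =
    {{(0, q), (0, q + 1)} | q. 0 \<le> q \<and> q \<le> k - 1} \<union>
    {{(q, - 1), (q, 0)} | q. - k + 1 \<le> q \<and> q \<le> 0} \<union> {{(- k, 0), (0, k)}}"

definition added_edges :: "int \<Rightarrow> (int \<times> int) set set" where
  "added_edges k =
    {{(q, 0), (q + 1, 0)} | q. 0 \<le> q \<and> q \<le> k - 1} \<union>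
    {{(- 1, q), (0, q)} | q. 1 \<le> q \<and> q \<le> k - 1} \<union> {{(k, 0), (0, k)}}"

text \<open>Indexes the removed vertical edges by the node from which the upward step starts. On the
  imaginary axis, y = k accounts for the wrap-around edge from ki to -k.\<close>

lemma up_removed_iff:
  assumes "k \<ge> 2" "(x, y) \<in> diamond k"
  shows "{(x, y), up k (x, y)} \<in> removed_edges k \<longleftrightarrow>
    x = 0 \<and> y \<ge> 0 \<or> - k < x \<and> x \<le> 0 \<and> y = - 1"
proof -
  obtain a b where ab: "up k (x, y) = (a, b)" by fastforce
  consider "\<bar>x\<bar> + \<bar>y + 1\<bar> \<le> k" "a = x" "b = y + 1"
    | "x \<ge> 0" "y = k - x" "a = x - k" "b = - x"
    | "x < 0" "y = k + x" "a = x + k + 1" "b = x + 1"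
    using assms ab by (auto simp: diamond_def split: if_splits)
  then show ?thesis
    unfolding ab
    by cases (use assms in \<open>auto simp: removed_edges_def doubleton_eq_iff diamond_def\<close>)
qed

text \<open>A surviving vertical edge is a parent edge in one of two orientations. The starting node
  is the child if x > 0 and y < 0, or x < 0 and y >= 0; in the remaining cases its upper neighbour
  is the child, also across the wrap-around.\<close>

lemma up_in_parent_edges:
  assumes "k \<ge> 2" "(x, y) \<in> diamond k"
    and "\<not> (x = 0 \<and> y \<ge> 0 \<or> - k < x \<and> x \<le> 0 \<and> y = - 1)"
  shows "{(x, y), up k (x, y)} \<in> parent_edges k"
proof -
  consider "x > 0" "y < 0" | "x < 0" "y \<ge> 0" | "x > 0" "y \<ge> 0" | "x \<le> 0" "y < - 1"
    using assms by (force simp: diamond_def)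
  then have "(x, y) \<noteq> (0, 0) \<and> parent k (x, y) = up k (x, y) \<or>
      up k (x, y) \<noteq> (0, 0) \<and> parent k (up k (x, y)) = (x, y)"
    by cases (use assms in \<open>auto simp: diamond_def\<close>)
  then have "\<exists>v\<in>diamond k - {(0, 0)}. {(x, y), up k (x, y)} = {v, parent k v}"
  proof (elim disjE conjE)
    assume "(x, y) \<noteq> (0, 0)" "parent k (x, y) = up k (x, y)"
    then show ?thesis using assms(2) by (intro bexI[of _ "(x, y)"]) (simp_all del: up.simps)
  next
    assume "up k (x, y) \<noteq> (0, 0)" "parent k (up k (x, y)) = (x, y)"
    then show ?thesis
      using up_diamond[OF assms(2)]
      by (intro bexI[of _ "up k (x, y)"]) (simp_all add: insert_commute del: up.simps)
  qed
  then show ?thesis unfolding parent_edges_def by blast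
qed

lemma added_in_parent_edges:
  assumes "k \<ge> 2" "e \<in> added_edges k"
  shows "e \<in> parent_edges k"
proof -
  consider q where "0 \<le> q" "q \<le> k - 1" "e = {(q + 1, 0), parent k (q + 1, 0)}"
    | q where "1 \<le> q" "q \<le> k - 1" "e = {(0, q), parent k (0, q)}"
    | "e = {(0, k), parent k (0, k)}"
    using assms by (auto simp: added_edges_def insert_commute)
  then obtain v where "v \<in> diamond k - {(0, 0)}" "e = {v, parent k v}"
  proof cases
    case (1 q)
    then show ?thesis using that[of "(q + 1, 0)"] by (simp add: diamond_def)
  next
    case (2 q)
    then show ?thesis using that[of "(0, q)"] by (simp add: diamond_def)
  next
    case 3
    then show ?thesis using that[of "(0, k)"] assms(1) by (simp add: diamond_def)
  qed
  then show ?thesis unfolding parent_edges_def by blast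
qed

text \<open>The moves along the positive real axis and out of the positive imaginary axis are the
  added edges. All other moves are vertical: an upward one is the vertical edge of the node itself,
  a downward one that of its parent.\<close>

lemma parent_edge_cases:
  assumes "k \<ge> 2" "(x, y) \<in> diamond k - {(0, 0)}"
  shows "{(x, y), parent k (x, y)} \<in> ({{v, up k v} | v. v \<in> diamond k} - removed_edges k) \<union> added_edges k"
    (is "?e \<in> ?R")
proof -
  have vert: "{(a, b), up k (a, b)} \<in> ?R"
    if "(a, b) \<in> diamond k" "\<not> (a = 0 \<and> b \<ge> 0 \<or> - k < a \<and> a \<le> 0 \<and> b = - 1)" for a b
    using that up_removed_iff[OF assms(1) that(1)] by blast
  have xy: "\<bar>x\<bar> + \<bar>y\<bar> \<le> k" "(x, y) \<noteq> (0, 0)"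
    using assms by (auto simp: diamond_def)
  consider "x > 0" "y = 0" | "x = 0" "y > 0" "y < k" | "x = 0" "y = k"
    | "x > 0" "y < 0" | "x < 0" "y \<ge> 0" | "x > 0" "y > 0" | "x \<le> 0" "y < 0"
    using xy by (smt (verit))
  then show ?thesis
  proof cases
    case 1
    then have "\<exists>q. ?e = {(q, 0), (q + 1, 0)} \<and> 0 \<le> q \<and> q \<le> k - 1"
      using xy by (intro exI[of _ "x - 1"]) auto
    then show ?thesis unfolding added_edges_def by blast
  next
    case 2
    then have "\<exists>q. ?e = {(- 1, q), (0, q)} \<and> 1 \<le> q \<and> q \<le> k - 1"
      by (intro exI[of _ y]) auto
    then show ?thesis unfolding added_edges_def by blast
  next
    case 3
    then have "?e = {(k, 0), (0, k)}" using assms by auto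
    then show ?thesis unfolding added_edges_def by blast
  next
    case 4
    then have "parent k (x, y) = up k (x, y)" using xy by auto
    then show ?thesis using vert[of x y] assms 4 by auto
  next
    case 5
    then have "parent k (x, y) = up k (x, y)" using xy by auto
    then show ?thesis using vert[of x y] assms 5 by auto
  next
    case 6
    then have "parent k (x, y) = (x, y - 1)" "up k (x, y - 1) = (x, y)" using xy by auto
    then show ?thesis
      using vert[of x "y - 1"] xy 6 by (simp add: insert_commute diamond_def)
  next
    case 7
    obtain a b where ab: "parent k (x, y) = (a, b)" by fastforce
    \<comment> \<open>At the bottom of a column the parent is the node whose upward step wraps
      around to (x, y). It has a > 0, and otherwise b < -1, so the edge is not among the removed
      ones.\<close>
    then have "a = x + k \<and> b = - x \<and> y = - (k + x) \<or> a = x \<and> b = y - 1 \<and> y > - (k + x)"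
      using 7 xy by (auto split: if_splits)
    then have "up k (a, b) = (x, y)" "(a, b) \<in> diamond k"
      "\<not> (a = 0 \<and> b \<ge> 0 \<or> - k < a \<and> a \<le> 0 \<and> b = - 1)"
      using 7 xy by (auto simp: diamond_def)
    then show ?thesis
      using vert[of a b] ab by (simp add: insert_commute)
  qed
qed

lemma parent_edges_eq:
  assumes "k \<ge> 2"
  shows "parent_edges k = ({{v, up k v} | v. v \<in> diamond k} - removed_edges k) \<union> added_edges k"
proof (intro equalityI subsetI)
  fix e assume "e \<in> parent_edges k"
  then obtain x y where "(x, y) \<in> diamond k - {(0, 0)}" "e = {(x, y), parent k (x, y)}"
    unfolding parent_edges_def by fast
  then show "e \<in> ({{v, up k v} | v. v \<in> diamond k} - removed_edges k) \<union> added_edges k"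
    using parent_edge_cases[OF assms] by blast
next
  fix e assume "e \<in> ({{v, up k v} | v. v \<in> diamond k} - removed_edges k) \<union> added_edges k"
  then consider "e \<in> added_edges k"
    | x y where "(x, y) \<in> diamond k" "e = {(x, y), up k (x, y)}" "e \<notin> removed_edges k"
    by fast
  then show "e \<in> parent_edges k"
  proof cases
    case 1
    then show ?thesis using assms added_in_parent_edges by blast
  next
    case 2
    then show ?thesis using assms up_in_parent_edges up_removed_iff by blast
  qed
qed

lemma image_Collect_doubleton:
  "(`) h ` {{f q, g q} | q. P q} = {{h (f q), h (g q)} | q. P q}"
proof -
  have "{{f q, g q} | q. P q} = (\<lambda>q. {f q, g q}) ` Collect P"
    "{{h (f q), h (g q)} | q. P q} = (\<lambda>q. {h (f q), h (g q)}) ` Collect P"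
    by blast+
  then show ?thesis by (simp add: image_image)
qed

lemma vertical_edges_eq: "vertical_edges k = (`) gauss ` {{v, up k v} | v. v \<in> diamond k}"
proof -
  have "vertical_edges k = (\<lambda>v. {v, gauss_mod k (v + \<i>)}) ` gauss ` diamond k"
    unfolding vertical_edges_def gauss_nodes_eq by blast
  also have "\<dots> = (\<lambda>v. {gauss v, gauss (up k v)}) ` diamond k"
    unfolding image_image by (rule image_cong) (simp_all only: gauss_mod_up)
  also have "\<dots> = (`) gauss ` {{v, up k v} | v. v \<in> diamond k}"
    unfolding image_Collect_doubleton by blast
  finally show ?thesis .
qed

lemma tree1_edges_eq:
  assumes "k \<ge> 2"
  shows "tree1_edges k = (`) gauss ` parent_edges k"
proof -
  have removed:
    "{{of_int q * \<i>, of_int (q + 1) * \<i>} | q. 0 \<le> q \<and> q \<le> k - 1} \<union>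
     {{of_int q - \<i>, of_int q} | q. - k + 1 \<le> q \<and> q \<le> 0} \<union> {{- of_int k, of_int k * \<i>}}
     = (`) gauss ` removed_edges k"
    unfolding removed_edges_def image_Un image_Collect_doubleton by simp
  have added:
    "{{of_int q, of_int (q + 1)} | q. 0 \<le> q \<and> q \<le> k - 1} \<union>
     {{-1 + of_int q * \<i>, of_int q * \<i>} | q. 1 \<le> q \<and> q \<le> k - 1} \<union>
     {{of_int k, of_int k * \<i>}} = (`) gauss ` added_edges k"
    unfolding added_edges_def image_Un image_Collect_doubleton by simp
  \<comment> \<open>Injectivity on sets of nodes lets the image commute with the set
    difference.\<close>
  have "inj ((`) gauss)"
    by (intro inj_on_image inj_on_subset[OF inj_gauss]) simp
  then show ?thesis
    unfolding tree1_edges_def parent_edges_eq[OF assms] image_Un image_set_diff[OF \<open>inj ((`) gauss)\<close>]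
      removed vertical_edges_eq[symmetric] added[symmetric]
    by (simp only: Un_assoc)
qed

lemma is_utree_tree1:
  assumes "k \<ge> 2"
  shows "is_utree \<lparr>nodes = gauss_nodes k, edges = tree1_edges k\<rparr>"
proof -
  have "is_utree \<lparr>nodes = diamond k, edges = parent_edges k\<rparr>"
    unfolding parent_edges_def
  \<comment> \<open>The depth is nonnegative on the diamond, so its strict decrease survives the
    passage to natural numbers.\<close>
  proof (rule is_utree_parent[where rank = "\<lambda>v. nat (depth k v)"])
    fix v assume v: "v \<in> diamond k" "v \<noteq> (0, 0)"
    then show "parent k v \<in> diamond k \<and> nat (depth k (parent k v)) < nat (depth k v)"
      using depth_parent[of k v] depth_nonneg[of "parent k v" k] assms by auto
  qed (use assms finite_diamond in \<open>auto simp: diamond_def\<close>)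
  from is_utree_image[OF this, of gauss] show ?thesis
    by (simp add: image_ugraph_def gauss_nodes_eq tree1_edges_eq[OF assms]
        inj_on_subset[OF inj_gauss])
qed

section \<open>The network is simple and contains the first tree\<close>

text \<open>Zero and the four units are distinct points of the diamond once k >= 1, hence
  incongruent. This excludes loops in the network.\<close>

lemma not_gauss_cong_0_unit:
  assumes "k \<ge> 1" "u \<in> {1, -1, \<i>, -\<i>}"
  shows "\<not> gauss_cong k 0 u"
proof -
  have "u \<in> gauss ` {(1, 0), (-1, 0), (0, 1), (0, -1)}"
    using assms by auto
  moreover have "{(1, 0), (-1, 0), (0, 1), (0, -1)} \<subseteq> diamond k - {(0, 0)}"
    using assms(1) by (auto simp: diamond_def)
  ultimately obtain v where "u = gauss v" "v \<noteq> (0, 0)" "v \<in> diamond k"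
    by blast
  moreover have "0 = gauss (0, 0)" by simp
  moreover have "(0, 0) \<in> diamond k" using assms by (simp add: diamond_def)
  ultimately show ?thesis
    using gauss_cong_diamond_eq[of "(0, 0)" k v] by metis
qed

lemma simple_gauss_network:
  assumes "k \<ge> 1"
  shows "simple_ugraph (gauss_network k)"
  unfolding simple_ugraph_def
proof (intro conjI ballI)
  show "finite (nodes (gauss_network k))"
    by (simp add: gauss_network_def gauss_nodes_eq finite_diamond)
next
  fix e assume "e \<in> edges (gauss_network k)"
  then obtain a b u where e: "e = {a, b}" "a \<in> gauss_nodes k" "b \<in> gauss_nodes k"
    and u: "u \<in> {1, -1, \<i>, -\<i>}" "gauss_cong k (a - b) u"
    unfolding gauss_network_def ugraph.simps by blast
  show "e \<subseteq> nodes (gauss_network k)"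
    using e by (simp add: gauss_network_def)
  have "a \<noteq> b"
    using not_gauss_cong_0_unit[OF assms u(1)] u(2) by force
  then show "card e = 2" using e by simp
qed

lemma gauss_network_edgeI:
  assumes "u \<in> diamond k" "v \<in> diamond k" "c \<in> {1, -1, \<i>, -\<i>}"
    and "gauss_cong k (gauss u) (gauss v + c)"
  shows "gauss ` {u, v} \<in> edges (gauss_network k)"
proof -
  have "gauss_cong k (gauss u - gauss v) c"
    using assms(4) by (simp only: gauss_cong_def diff_diff_eq)
  moreover have "gauss u \<in> gauss_nodes k" "gauss v \<in> gauss_nodes k"
    using assms unfolding gauss_nodes_eq by blast+
  moreover have "gauss ` {u, v} = {gauss u, gauss v}" by simp
  ultimately show ?thesis
    unfolding gauss_network_def ugraph.simps using assms(3) by blast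
qed

lemma tree1_edges_subset:
  assumes "k \<ge> 2"
  shows "tree1_edges k \<subseteq> edges (gauss_network k)"
proof -
  have "gauss ` e \<in> edges (gauss_network k)"
    if e: "e \<in> {{v, up k v} | v. v \<in> diamond k} \<union> added_edges k" for e
  proof -
    consider v where "v \<in> diamond k" "e = {v, up k v}"
      | q where "0 \<le> q" "q \<le> k - 1" "e = {(q, 0), (q + 1, 0)}"
      | q where "1 \<le> q" "q \<le> k - 1" "e = {(- 1, q), (0, q)}"
      | "e = {(k, 0), (0, k)}"
      using e unfolding added_edges_def by blast
    then show ?thesis
    proof cases
      case (1 v)
      then show ?thesis
        using up_diamond up_cong gauss_network_edgeI[of "up k v" k v \<i>]
        by (simp add: insert_commute)
    next
      case (2 q)
      have "gauss_cong k (gauss (q + 1, 0)) (gauss (q, 0) + 1)"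
        using gauss_cong_iff[of k "q + 1" 0 "q + 1" 0] by (simp add: exI[of _ 0])
      then show ?thesis
        unfolding 2(3) insert_commute[of "(q, 0)"] using 2 assms
        by (intro gauss_network_edgeI[where c = 1]) (simp_all add: diamond_def)
    next
      case (3 q)
      have "gauss_cong k (gauss (0, q)) (gauss (-1, q) + 1)"
        using gauss_cong_iff[of k 0 q 0 q] by (simp add: exI[of _ 0])
      then show ?thesis
        unfolding 3(3) insert_commute[of "(- 1, q)"] using 3 assms
        by (intro gauss_network_edgeI[where c = 1]) (simp_all add: diamond_def)
    next
      case 4
      \<comment> \<open>The nodes k and ki are adjacent through a wrap-around: k and -1 + ki differ
        by a multiple of alpha, with quotient -i, so the step by -1 from ki ends at k.\<close>
      have "\<exists>m n. k - -1 = k * m - (k + 1) * n \<and> 0 - k = (k + 1) * m + k * n"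
        by (intro exI[of _ 0] exI[of _ "-1"]) simp
      then have "gauss_cong k (gauss (k, 0)) (gauss (-1, k))"
        by (simp only: gauss_cong_iff)
      moreover have "gauss (-1, k) = gauss (0, k) + (-1)" by simp
      ultimately show ?thesis
        unfolding 4 using assms
        by (intro gauss_network_edgeI[where c = "-1"]) (simp_all only: diamond_def, auto)
    qed
  qed
  then show ?thesis
    unfolding tree1_edges_eq[OF assms] parent_edges_eq[OF assms] by blast
qed

section \<open>Rotation as an automorphism of the network\<close>

lemma gauss_rot_eq: "gauss_rot z = \<i> * z"
  by (simp add: gauss_rot_def complex_eq_iff)

lemma inj_gauss_rot: "inj gauss_rot"
  by (simp add: inj_def gauss_rot_eq)

lemma gauss_rot_gauss: "gauss_rot (gauss (x, y)) = gauss (- y, x)"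
  by (simp add: gauss_rot_def complex_eq_iff)

lemma gauss_rot_nodes: "gauss_rot ` gauss_nodes k = gauss_nodes k"
\<comment> \<open>An injective self-map of a finite set is onto, so the inclusion of the image
  suffices and the inverse rotation need not be treated.\<close>
proof (rule endo_inj_surj)
  show "finite (gauss_nodes k)" by (simp add: gauss_nodes_eq finite_diamond)
  show "inj_on gauss_rot (gauss_nodes k)" by (rule inj_on_subset[OF inj_gauss_rot]) simp
  have "gauss (- y, x) \<in> gauss ` diamond k" if "(x, y) \<in> diamond k" for x y
    using that by (intro imageI) (simp add: diamond_def)
  then show "gauss_rot ` gauss_nodes k \<subseteq> gauss_nodes k"
    unfolding gauss_nodes_eq by (auto simp: gauss_rot_gauss simp del: gauss.simps)
qed

text \<open>Rotation is multiplication by i, which commutes with the factor alpha and preserves the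
  Gaussian integers.\<close>

lemma gauss_cong_rot:
  assumes "gauss_cong k z w"
  shows "gauss_cong k (gauss_rot z) (gauss_rot w)"
proof -
  obtain c where c: "c \<in> gauss_ints" "z - w = gauss_alpha k * c"
    using assms unfolding gauss_cong_def by blast
  then obtain x y where "c = gauss (x, y)" unfolding gauss_ints_eq by fast
  then have "gauss_rot c \<in> gauss_ints" by (simp only: gauss_rot_gauss gauss_ints_eq rangeI)
  moreover have "gauss_rot z - gauss_rot w = gauss_alpha k * gauss_rot c"
    using c(2) by (simp add: gauss_rot_eq flip: right_diff_distrib)
  ultimately show ?thesis unfolding gauss_cong_def by blast
qed

text \<open>The finiteness argument used for the nodes is repeated for the edges; the inclusion
  holds because rotation permutes the four units and respects congruence.\<close>

lemma gauss_rot_network: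
  assumes "k \<ge> 1"
  shows "image_ugraph gauss_rot (gauss_network k) = gauss_network k"
proof -
  let ?E = "edges (gauss_network k)"
  have nodes: "nodes (gauss_network k) = gauss_nodes k"
    by (simp add: gauss_network_def)
  have "(`) gauss_rot ` ?E = ?E"
  proof (rule endo_inj_surj)
    have "?E \<subseteq> Pow (gauss_nodes k)"
      using simple_gauss_network[OF assms] by (auto simp: simple_ugraph_def nodes)
    then show "finite ?E"
      by (rule finite_subset) (simp add: gauss_nodes_eq finite_diamond)
    have "inj ((`) gauss_rot)" by (intro inj_on_image inj_on_subset[OF inj_gauss_rot]) simp
    then show "inj_on ((`) gauss_rot) ?E" by (rule inj_on_subset) simp
    show "(`) gauss_rot ` ?E \<subseteq> ?E"
    proof (rule image_subsetI)
      fix e assume "e \<in> ?E"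
      then obtain a b u where e: "e = {a, b}" "a \<in> gauss_nodes k" "b \<in> gauss_nodes k"
        and u: "u \<in> {1, -1, \<i>, -\<i>}" "gauss_cong k (a - b) u"
        unfolding gauss_network_def ugraph.simps by blast
      have "gauss_rot u \<in> {1, -1, \<i>, -\<i>}" using u(1) by (auto simp: gauss_rot_eq)
      moreover have "gauss_cong k (gauss_rot a - gauss_rot b) (gauss_rot u)"
        using gauss_cong_rot[OF u(2)] by (simp add: gauss_rot_eq right_diff_distrib)
      moreover have "gauss_rot a \<in> gauss_nodes k" "gauss_rot b \<in> gauss_nodes k"
        using e gauss_rot_nodes by blast+
      moreover have "gauss_rot ` e = {gauss_rot a, gauss_rot b}" using e by simp
      ultimately show "gauss_rot ` e \<in> ?E"
        unfolding gauss_network_def ugraph.simps by blast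
    qed
  qed
  then show ?thesis
    by (simp add: image_ugraph_def nodes gauss_rot_nodes)
qed

theorem lemma2:
  fixes k :: int
  assumes "k \<ge> 2"
  shows "\<forall>j\<in>{1, 2, 3, 4}. is_spanning_utree (gauss_tree k j) (gauss_network k)"
proof -
  let ?T = "\<lparr>nodes = gauss_nodes k, edges = tree1_edges k\<rparr>"
  have "is_spanning_utree ?T (gauss_network k)"
    using is_utree_tree1 tree1_edges_subset simple_gauss_network assms
    by (auto simp: is_spanning_utree_def is_usubgraph_def is_utree_def gauss_network_def)
  \<comment> \<open>The claim holds for any number \<open>n\<close> of rotations; the four trees are
    the instances \<open>n = j - 1\<close>.\<close>
  then have "is_spanning_utree ((image_ugraph gauss_rot ^^ n) ?T) (gauss_network k)" for n
  proof (induction n)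
    case (Suc n)
    have "inj_on gauss_rot (nodes (gauss_network k))"
      by (rule inj_on_subset[OF inj_gauss_rot]) simp
    then show ?case
      using is_spanning_utree_image[OF Suc.IH[OF Suc.prems]] gauss_rot_network assms by simp
  qed simp
  then show ?thesis by (simp only: gauss_tree_def) blast
qed

end
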